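(* Let $X$ be a normal space. Then every one-point subset of $X$ is a $G_\delta$-set if and only if for every $p\in X$ the function $\chi_{\{p\}}$ belongs to $B_1(X)$ and the ideal of $B_1(X)$ generated by $\chi_{\{p\}}$ is a minimal ideal of $B_1(X)$.
   Context: All topological spaces are nonempty and $T_1$; in particular normal spaces are $T_1$. $B_1(X)$ is the ring (with pointwise operations) of all functions $X\to\mathbb{R}$ that are pointwise limits of sequences of continuous real-valued functions on $X$. $\chi_S$ is the characteristic function of $S\subseteq X$. A minimal ideal is a non-zero ideal that properly contains no non-zero ideal. *)

theory Defs
  imports "HOL-Analysis.Analysis" "HOL-Algebra.Ideal"
begin

text \<open>
  Real-valued functions on the carrier of \<open>X\<close> are represented by the elements of
  \<open>extensional (topspace X)\<close>, so that equality in the ring is pointwise equality on the space.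
\<close>

definition baire_one :: "'a topology \<Rightarrow> ('a \<Rightarrow> real) set" where
  "baire_one X =
     {f \<in> extensional (topspace X).
        \<exists>g :: nat \<Rightarrow> 'a \<Rightarrow> real.
          (\<forall>n. continuous_map X euclideanreal (g n)) \<and>
          (\<forall>x \<in> topspace X. (\<lambda>n. g n x) \<longlonglongrightarrow> f x)}"

definition baire_one_ring :: "'a topology \<Rightarrow> ('a \<Rightarrow> real) ring" where
  "baire_one_ring X =
     \<lparr>carrier = baire_one X,
      mult = (\<lambda>f g. \<lambda>x\<in>topspace X. f x * g x),
      one = (\<lambda>x\<in>topspace X. 1),
      zero = (\<lambda>x\<in>topspace X. 0),
      add = (\<lambda>f g. \<lambda>x\<in>topspace X. f x + g x)\<rparr>"

definition char_fun :: "'a topology \<Rightarrow> 'a set \<Rightarrow> 'a \<Rightarrow> real" where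
  "char_fun X S = (\<lambda>x\<in>topspace X. indicator S x)"

definition minimal_ideal :: "'b set \<Rightarrow> ('b, 'm) ring_scheme \<Rightarrow> bool" where
  "minimal_ideal I R \<longleftrightarrow>
     ideal I R \<and> I \<noteq> {\<zero>\<^bsub>R\<^esub>} \<and>
     (\<nexists>J. ideal J R \<and> J \<noteq> {\<zero>\<^bsub>R\<^esub>} \<and> J \<subset> I)"

lemma baire_one_const: "(\<lambda>x\<in>topspace X. c) \<in> baire_one X"
  unfolding baire_one_def by (auto intro!: exI[of _ "\<lambda>n x. c"])

lemma baire_one_add:
  assumes "f \<in> baire_one X" "g \<in> baire_one X"
  shows "(\<lambda>x\<in>topspace X. f x + g x) \<in> baire_one X"
proof -
  obtain u v where
    "\<And>n. continuous_map X euclideanreal (u n)" "\<And>x. x \<in> topspace X \<Longrightarrow> (\<lambda>n. u n x) \<longlonglongrightarrow> f x"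
    "\<And>n. continuous_map X euclideanreal (v n)" "\<And>x. x \<in> topspace X \<Longrightarrow> (\<lambda>n. v n x) \<longlonglongrightarrow> g x"
    using assms unfolding baire_one_def by blast
  then show ?thesis
    unfolding baire_one_def
    by (auto intro!: exI[of _ "\<lambda>n x. u n x + v n x"] continuous_map_add tendsto_add)
qed

lemma baire_one_mult:
  assumes "f \<in> baire_one X" "g \<in> baire_one X"
  shows "(\<lambda>x\<in>topspace X. f x * g x) \<in> baire_one X"
proof -
  obtain u v where
    "\<And>n. continuous_map X euclideanreal (u n)" "\<And>x. x \<in> topspace X \<Longrightarrow> (\<lambda>n. u n x) \<longlonglongrightarrow> f x"
    "\<And>n. continuous_map X euclideanreal (v n)" "\<And>x. x \<in> topspace X \<Longrightarrow> (\<lambda>n. v n x) \<longlonglongrightarrow> g x"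
    using assms unfolding baire_one_def by blast
  then show ?thesis
    unfolding baire_one_def
    by (auto intro!: exI[of _ "\<lambda>n x. u n x * v n x"] continuous_map_real_mult tendsto_mult)
qed

lemma baire_one_extensional: "f \<in> baire_one X \<Longrightarrow> f \<in> extensional (topspace X)"
  by (simp add: baire_one_def)

lemma cring_baire_one_ring: "cring (baire_one_ring X)"
proof (rule cringI)
  show "abelian_group (baire_one_ring X)"
  proof (rule abelian_groupI)
    fix f assume f: "f \<in> carrier (baire_one_ring X)"
    have "(\<lambda>x\<in>topspace X. (\<lambda>x\<in>topspace X. -1) x * f x) \<in> baire_one X"
      using f by (intro baire_one_mult baire_one_const) (simp add: baire_one_ring_def)
    moreover have "(\<lambda>x\<in>topspace X. (\<lambda>x\<in>topspace X. (\<lambda>x\<in>topspace X. -1) x * f x) x + f x)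
        = (\<lambda>x\<in>topspace X. 0)"
      by (rule restrict_ext) simp
    ultimately show "\<exists>g\<in>carrier (baire_one_ring X).
        g \<oplus>\<^bsub>baire_one_ring X\<^esub> f = \<zero>\<^bsub>baire_one_ring X\<^esub>"
      unfolding baire_one_ring_def by (simp del: restrict_apply) blast
  qed (auto simp: baire_one_ring_def baire_one_add baire_one_const add_ac fun_eq_iff
        dest!: baire_one_extensional simp: extensional_def)
  show "Group.comm_monoid (baire_one_ring X)"
    by (rule comm_monoidI)
      (auto simp: baire_one_ring_def baire_one_mult baire_one_const mult_ac fun_eq_iff
        dest!: baire_one_extensional simp: extensional_def)
qed (auto simp: baire_one_ring_def fun_eq_iff algebra_simps)

end

theory Submission
  imports Defs
begin

text \<open>
  If a closed set \<open>S\<close> in a normal space is the intersection of decreasing open sets \<open>C n\<close>, then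
  Urysohn functions that are 1 on \<open>S\<close> and 0 off \<open>C n\<close> converge pointwise to \<open>\<chi>\<^sub>S\<close>. Conversely, if
  continuous \<open>g n\<close> converge to \<open>\<chi>\<^sub>S\<close>, then \<open>S\<close> is the set of points at which \<open>g n > 1/2\<close> for
  infinitely many \<open>n\<close>, which is a \<open>G\<^sub>\<delta>\<close>-set. Minimality is automatic: every element of the ideal
  generated by \<open>\<chi>\<^bsub>{p}\<^esub>\<close> is a real multiple of \<open>\<chi>\<^bsub>{p}\<^esub>\<close>.
\<close>

lemma char_fun_baire_one:
  assumes "normal_space X" "closedin X S" "gdelta_in X S"
  shows "char_fun X S \<in> baire_one X"
proof -
  obtain C where C: "\<And>n. openin X (C n)" "\<And>n. C (Suc n) \<subseteq> C n" "\<Inter>(range C) = S"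
    using assms(3) by (auto simp: gdelta_in_descending)
  have "\<exists>f. continuous_map X euclideanreal f \<and> f ` S \<subseteq> {1} \<and> f ` (topspace X - C n) \<subseteq> {0}" for n
  proof -
    have "closedin X (topspace X - C n)" "disjnt S (topspace X - C n)"
      using C by (auto simp: disjnt_def)
    then show ?thesis
      using Urysohn_lemma_alt[OF assms(1,2)] by metis
  qed
  then obtain g where g: "\<And>n. continuous_map X euclideanreal (g n)"
      "\<And>n. g n ` S \<subseteq> {1}" "\<And>n. g n ` (topspace X - C n) \<subseteq> {0}"
    by metis
  have "(\<lambda>n. g n x) \<longlonglongrightarrow> char_fun X S x" if x: "x \<in> topspace X" for x
  proof (cases "x \<in> S")
    case True
    then have "g n x = 1" for n
      using g(2) by blast
    then show ?thesis
      using True x by (simp add: char_fun_def)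
  next
    case False
    then obtain k where k: "x \<notin> C k"
      using C(3) by blast
    \<comment> \<open>The sets \<open>C n\<close> decrease, so a point outside \<open>C k\<close>
      stays outside all later ones.\<close>
    have "g n x = 0" if "n \<ge> k" for n
      using lift_Suc_antimono_le[of C, OF C(2) that] k x g(3) by blast
    then have "\<forall>\<^sub>F n in sequentially. g n x = 0"
      by (rule eventually_sequentiallyI)
    then show ?thesis
      using False x by (simp add: char_fun_def tendsto_eventually)
  qed
  then show ?thesis
    using g(1) unfolding baire_one_def by (auto simp: char_fun_def)
qed

lemma gdelta_in_if_char_fun_baire_one:
  assumes "S \<subseteq> topspace X" "char_fun X S \<in> baire_one X"
  shows "gdelta_in X S"
proof -
  obtain g where g: "\<And>n::nat. continuous_map X euclideanreal (g n)"
      and lim: "\<And>x. x \<in> topspace X \<Longrightarrow> (\<lambda>n. g n x) \<longlonglongrightarrow> char_fun X S x"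
    using assms(2) unfolding baire_one_def by blast
  \<comment> \<open>Intersecting over \<open>N\<close> expresses "infinitely often" as a countable
    intersection of open sets. The threshold 1/2 lies strictly between the two possible limits 0 and
    1.\<close>
  define U where "U N = (\<Union>n\<in>{N..}. {x \<in> topspace X. g n x \<in> {1/2<..}})" for N
  have "openin X (U N)" for N
    unfolding U_def
    by (intro openin_Union, elim imageE, hypsubst)
      (rule openin_continuous_map_preimage[OF g], simp)
  then have "gdelta_in X (\<Inter>(range U))"
    by (intro gdelta_in_Inter) (auto intro: open_imp_gdelta_in)
  moreover have "\<Inter>(range U) = S"
  proof (intro equalityI subsetI)
    fix x assume x: "x \<in> \<Inter>(range U)"
    then have X: "x \<in> topspace X"
      by (auto simp: U_def)
    show "x \<in> S"
    proof (rule ccontr)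
      assume "x \<notin> S"
      then have "(\<lambda>n. g n x) \<longlonglongrightarrow> 0"
        using lim[OF X] X by (simp add: char_fun_def)
      then have "\<forall>\<^sub>F n in sequentially. g n x < 1/2"
        by (rule order_tendstoD) simp
      then obtain N where N: "\<And>n. n \<ge> N \<Longrightarrow> g n x < 1/2"
        unfolding eventually_sequentially by blast
      have "x \<in> U N"
        using x by blast
      then show False
        using N unfolding U_def by (auto dest: less_asym)
    qed
  next
    fix x assume x: "x \<in> S"
    then have X: "x \<in> topspace X"
      using assms(1) by blast
    have "(\<lambda>n. g n x) \<longlonglongrightarrow> 1"
      using lim[OF X] x X by (simp add: char_fun_def)
    then have "\<forall>\<^sub>F n in sequentially. g n x > 1/2"
      by (rule order_tendstoD) simp
    then obtain N where N: "\<And>n. n \<ge> N \<Longrightarrow> g n x > 1/2"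
      unfolding eventually_sequentially by blast
    \<comment> \<open>The index \<open>max M N\<close> is admissible in the union defining
      \<open>U M\<close> and also late enough for the bound from \<open>N\<close>.\<close>
    have "x \<in> U M" for M
      using X N[of "max M N"] unfolding U_def by (intro UN_I[of "max M N"]) auto
    then show "x \<in> \<Inter>(range U)"
      by blast
  qed
  ultimately show ?thesis
    by simp
qed

lemma minimal_ideal_char_fun_singleton:
  assumes p: "p \<in> topspace X" and mem: "char_fun X {p} \<in> carrier (baire_one_ring X)"
  shows "minimal_ideal (genideal (baire_one_ring X) {char_fun X {p}}) (baire_one_ring X)"
proof -
  let ?R = "baire_one_ring X" and ?e = "char_fun X {p}"
  interpret R: cring ?R
    by (rule cring_baire_one_ring)
  \<comment> \<open>By commutativity the ideal consists of the ring multiples of \<open>?e\<close>,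
    which makes its elements explicit.\<close>
  have Idl: "genideal ?R {?e} = cgenideal ?R ?e"
    using R.cgenideal_eq_genideal[OF mem] by simp
  have e_neq: "?e \<noteq> \<zero>\<^bsub>?R\<^esub>"
    using p by (auto simp: baire_one_ring_def char_fun_def dest: fun_cong[of _ _ p])
  have "cgenideal ?R ?e \<subseteq> J" if J: "ideal J ?R" "J \<noteq> {\<zero>\<^bsub>?R\<^esub>}" "J \<subseteq> cgenideal ?R ?e" for J
  proof -
    interpret J: ideal J ?R
      by (rule J(1))
    obtain f where f: "f \<in> J" "f \<noteq> \<zero>\<^bsub>?R\<^esub>"
      using J(2) J.zero_closed by blast
    obtain g where "f = g \<otimes>\<^bsub>?R\<^esub> ?e"
      using f(1) J(3) by (auto simp: cgenideal_def)
    \<comment> \<open>Multiplying by \<open>?e\<close> erases every value of \<open>g\<close> except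
      the one at \<open>p\<close>, so \<open>g\<close> may be replaced by the constant
      \<open>g p\<close>.\<close>
    then have f_eq: "f = (\<lambda>x\<in>topspace X. g p * ?e x)"
      by (auto simp: baire_one_ring_def char_fun_def fun_eq_iff indicator_def)
    have gp: "g p \<noteq> 0"
      using f(2) f_eq by (auto simp: baire_one_ring_def)
    \<comment> \<open>Nonzero constants are invertible in the ring, so \<open>?e\<close> is
      recovered from \<open>f\<close> inside \<open>J\<close>.\<close>
    have "(\<lambda>x\<in>topspace X. 1 / g p) \<in> carrier ?R"
      by (simp add: baire_one_ring_def baire_one_const)
    then have "(\<lambda>x\<in>topspace X. 1 / g p) \<otimes>\<^bsub>?R\<^esub> f \<in> J"
      using f(1) by (rule J.I_l_closed[rotated])
    moreover have "(\<lambda>x\<in>topspace X. 1 / g p) \<otimes>\<^bsub>?R\<^esub> f = ?e"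
      using gp by (auto simp: f_eq baire_one_ring_def char_fun_def fun_eq_iff)
    ultimately show ?thesis
      using R.cgenideal_minimal[OF J(1)] by simp
  qed
  then show ?thesis
    unfolding minimal_ideal_def Idl
    using R.cgenideal_ideal[OF mem] R.cgenideal_self[OF mem] e_neq by blast
qed

theorem corollary2p4:
  fixes X :: "'a topology"
  assumes "topspace X \<noteq> {}" and "t1_space X" and "normal_space X"
  shows "(\<forall>p\<in>topspace X. gdelta_in X {p}) \<longleftrightarrow>
    (\<forall>p\<in>topspace X.
       char_fun X {p} \<in> carrier (baire_one_ring X) \<and>
       minimal_ideal (genideal (baire_one_ring X) {char_fun X {p}}) (baire_one_ring X))"
proof -
  \<comment> \<open>The T1 axiom makes \<open>{p}\<close> closed, as the Urysohn argument
    requires.\<close>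
  have "gdelta_in X {p} \<longleftrightarrow> char_fun X {p} \<in> carrier (baire_one_ring X)"
    if "p \<in> topspace X" for p
    using that assms(2,3) char_fun_baire_one[of X "{p}"]
      gdelta_in_if_char_fun_baire_one[of "{p}" X] closedin_t1_singleton[of X p]
    by (auto simp: baire_one_ring_def)
  \<comment> \<open>Membership already implies minimality, so each conjunction reduces to its first
    half.\<close>
  then show ?thesis
    by (intro ball_cong refl) (metis minimal_ideal_char_fun_singleton)
qed

end
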